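(* In the setting described in the context (fixed mesh, geometry, quadrature points, local variation spaces $\widehat V_e$, finite-dimensional continuous candidate space $\mathcal Z_h$ containing constants, and common material sum $c>0$), for every $z\in\mathcal Z_h$, $$\gamma_h(z)=c-\max_{e,q}\nu\bigl(R_z(X_e(\xi_{eq}))-2cI_3\bigr).$$ The maximum of $\gamma_h$ over the compatible space $\mathcal Z_h^0$ is attained, and $$\gamma_h^*:=\max_{z\in\mathcal Z_h^0}\gamma_h(z)=c-\min_{z\in\mathcal Z_h^0}\max_{e,q}\nu\bigl(R_z(X_e(\xi_{eq}))-2cI_3\bigr),\qquad 0\le\gamma_h^*\le c .$$
   Context: Matrices: $A:B=\operatorname{tr}(A^TB)$; $\operatorname{cof}A$ is the matrix of signed $2\times2$ minors; $A\times B=\operatorname{cof}(A+B)-\operatorname{cof}A-\operatorname{cof}B$ for $A,B\in\mathbb R^{3\times3}$. Mesh: $\Omega_h\subset\mathbb R^3$ is a connected bounded Lipschitz domain partitioned into finitely many conforming cells $K_e=X_e(\widehat K_e)$, where each $X_e$ is an orientation-preserving one-to-one map of a fixed parent cell $\widehat K_e$ with bounded first derivatives and bounded inverse derivatives, the maps agreeing on shared faces. $J_{X,e}=D_\xi X_e$ ($D_\xi$: parent derivative, rows are vector components). For each cell a finite nonempty set of quadrature points $\xi_{eq}\in\widehat K_e$ with weights $w_{eq}$ is fixed, and $\mathcal L_e[f]=\sum_q w_{eq}f(\xi_{eq})-\int_{\widehat K_e}f\,d\xi$. $\widehat V_e$ is a fixed space of vector fields on $\widehat K_e$ (local variations, no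 boundary condition). $\mathcal Z_h$ is a fixed finite-dimensional linear space of continuous, piecewise differentiable vector fields $z:\Omega_h\to\mathbb R^3$ containing the constant vectors, with no prescribed trace; $z_e=z\circ X_e$. The physical gradient at a quadrature point, evaluated from cell $e$, is $R_z(X_e(\xi))=D_\xi z_e(\xi)\,J_{X,e}(\xi)^{-1}$. Put $\mathcal T_e(z_e;u,v)=\mathcal L_e[D_\xi z_e:(D_\xi u\times D_\xi v)]$ and $$\mathcal Z_h^0=\{z\in\mathcal Z_h:\mathcal T_e(z_e;u,v)=0\ \text{for every }e\text{ and all }u,v\in\widehat V_e\}.$$ Material: on each cell, $W_{\mathrm{iso},e}(F)=c_{1,e}(J^{-2/3}F:F-3)+c_{2,e}(J^{-4/3}\operatorname{cof}F:\operatorname{cof}F-3)$ with $J=\det F>0$, $c_{1,e},c_{2,e}\ge0$, and $c_{1,e}+c_{2,e}=c>0$ the same for all cells. Its Hessian at the identity, $\mathcal H_c=D^2W_{\mathrm{iso},e}(I_3)$, is independent of $e$. Put $\mathcal A[H,L]=2H:L+\tfrac23(\operatorname{tr}H)(\operatorname{tr}L)$. Coefficient loss: for $U\in\mathbb R^{3\times3}$, $\displaystyle\nu(U)=\sup_{0\ne H\in\mathbb R^{3\times3}}\frac{-U:(H\times H)}{\mathcal A[H,H]}$. Margin: $\displaystyle\gamma_h(z)=\min_{e,q}\ \inf_{0\ne H\in\mathbb R^{3\times3}}\frac{\mathcal H_c[H,H]+R_z(X_e(\xi_{eq})):(H\times H)}{\mathcal A[H,H]}$. *)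

theory Defs
  imports "HOL-Analysis.Analysis" "HOL-Library.Function_Algebras"
begin

section \<open>Matrix algebra\<close>

definition frob :: "real^3^3 \<Rightarrow> real^3^3 \<Rightarrow> real" where
  "frob A B = trace (transpose A ** B)"

text \<open>The index type \<open>3\<close> carries arithmetic modulo 3; with cyclic indices the
  checkerboard sign of the minor is already accounted for.\<close>

definition cof :: "real^3^3 \<Rightarrow> real^3^3" where
  "cof A = (\<chi> i j. A $ (i + 1) $ (j + 1) * A $ (i + 2) $ (j + 2)
                  - A $ (i + 1) $ (j + 2) * A $ (i + 2) $ (j + 1))"

lemma cof_transpose_mult: "transpose (cof A) ** A = det A *\<^sub>R mat 1"
proof -
  have arith: "(4::3) = 1" "(5::3) = 2"
    by simp_all
  show ?thesis
    by (simp add: vec_eq_iff forall_3 cof_def matrix_matrix_mult_def transpose_def mat_def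
        sum_3 det_3 arith) (simp add: algebra_simps)
qed

definition tcross :: "real^3^3 \<Rightarrow> real^3^3 \<Rightarrow> real^3^3" where
  "tcross A B = cof (A + B) - cof A - cof B"

definition refform :: "real^3^3 \<Rightarrow> real^3^3 \<Rightarrow> real" where
  "refform H L = 2 * frob H L + 2 / 3 * trace H * trace L"

definition coeff_loss :: "real^3^3 \<Rightarrow> real" where
  "coeff_loss U = (SUP H\<in>- {0}. - frob U (tcross H H) / refform H H)"


section \<open>Material\<close>

definition W_iso :: "real \<Rightarrow> real \<Rightarrow> real^3^3 \<Rightarrow> real" where
  "W_iso a b F = a * (det F powr (- 2 / 3) * frob F F - 3)
               + b * (det F powr (- 4 / 3) * frob (cof F) (cof F) - 3)"

definition hessian :: "('a::real_normed_vector \<Rightarrow> real) \<Rightarrow> 'a \<Rightarrow> 'a \<Rightarrow> 'a \<Rightarrow> real" where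
  "hessian f x H L = frechet_derivative (\<lambda>y. frechet_derivative f (at y) L) (at x) H"


section \<open>Domains and fields\<close>

text \<open>Near each boundary point the set is the strict epigraph, in some unit direction \<open>n\<close>,
  of a Lipschitz function on the hyperplane orthogonal to \<open>n\<close>.\<close>

definition lipschitz_domain :: "'a::euclidean_space set \<Rightarrow> bool" where
  "lipschitz_domain S \<longleftrightarrow> open S \<and> S \<noteq> {} \<and>
     (\<forall>p\<in>frontier S. \<exists>n r L \<phi>. norm n = 1 \<and> r > 0 \<and> L-lipschitz_on {y. y \<bullet> n = 0} \<phi> \<and>
        S \<inter> ball p r = {x \<in> ball p r. \<phi> (x - (x \<bullet> n) *\<^sub>R n) < x \<bullet> n})"

definition fscale :: "real \<Rightarrow> ('a \<Rightarrow> 'b::real_vector) \<Rightarrow> 'a \<Rightarrow> 'b" where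
  "fscale r f = (\<lambda>x. r *\<^sub>R f x)"

global_interpretation fields: vector_space fscale
  by unfold_locales (auto simp: fscale_def fun_eq_iff algebra_simps)


section \<open>Discretisation\<close>

text \<open>One-sided derivatives at boundary points of a parent cell are unique because the cell
  is convex with nonempty interior. Rows of the matrix correspond to vector components.\<close>

abbreviation Dcell :: "(real^3) set \<Rightarrow> (real^3 \<Rightarrow> real^3) \<Rightarrow> real^3 \<Rightarrow> real^3^3" where
  "Dcell K f \<xi> \<equiv> jacobian f (at \<xi> within K)"

text \<open>The gradient at the image of the parent point \<open>\<xi>\<close>, evaluated from cell \<open>e\<close>.\<close>

definition phys_grad ::
  "('e \<Rightarrow> (real^3) set) \<Rightarrow> ('e \<Rightarrow> real^3 \<Rightarrow> real^3) \<Rightarrow> (real^3 \<Rightarrow> real^3) \<Rightarrow> 'e \<Rightarrow> real^3 \<Rightarrow> real^3^3"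
where
  "phys_grad K X z e \<xi> = Dcell (K e) (z \<circ> X e) \<xi> ** matrix_inv (Dcell (K e) (X e) \<xi>)"

definition quad_defect ::
  "('e \<Rightarrow> (real^3) set) \<Rightarrow> ('e \<Rightarrow> 'q set) \<Rightarrow> ('e \<Rightarrow> 'q \<Rightarrow> real^3) \<Rightarrow> ('e \<Rightarrow> 'q \<Rightarrow> real)
    \<Rightarrow> 'e \<Rightarrow> (real^3 \<Rightarrow> real) \<Rightarrow> real"
where
  "quad_defect K Q pt w e f =
     (\<Sum>q\<in>Q e. w e q * f (pt e q)) - (LINT \<xi>:K e|lebesgue. f \<xi>)"

definition compat_integrand ::
  "(real^3) set \<Rightarrow> (real^3 \<Rightarrow> real^3) \<Rightarrow> (real^3 \<Rightarrow> real^3) \<Rightarrow> (real^3 \<Rightarrow> real^3) \<Rightarrow> real^3 \<Rightarrow> real"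
where
  "compat_integrand K ze u v \<xi> = frob (Dcell K ze \<xi>) (tcross (Dcell K u \<xi>) (Dcell K v \<xi>))"

definition compat_form ::
  "('e \<Rightarrow> (real^3) set) \<Rightarrow> ('e \<Rightarrow> 'q set) \<Rightarrow> ('e \<Rightarrow> 'q \<Rightarrow> real^3) \<Rightarrow> ('e \<Rightarrow> 'q \<Rightarrow> real)
    \<Rightarrow> 'e \<Rightarrow> (real^3 \<Rightarrow> real^3) \<Rightarrow> (real^3 \<Rightarrow> real^3) \<Rightarrow> (real^3 \<Rightarrow> real^3) \<Rightarrow> real"
where
  "compat_form K Q pt w e ze u v = quad_defect K Q pt w e (compat_integrand (K e) ze u v)"

definition compat_space ::
  "'e set \<Rightarrow> ('e \<Rightarrow> (real^3) set) \<Rightarrow> ('e \<Rightarrow> real^3 \<Rightarrow> real^3)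
    \<Rightarrow> ('e \<Rightarrow> 'q set) \<Rightarrow> ('e \<Rightarrow> 'q \<Rightarrow> real^3) \<Rightarrow> ('e \<Rightarrow> 'q \<Rightarrow> real)
    \<Rightarrow> ('e \<Rightarrow> (real^3 \<Rightarrow> real^3) set) \<Rightarrow> (real^3 \<Rightarrow> real^3) set \<Rightarrow> (real^3 \<Rightarrow> real^3) set"
where
  "compat_space E K X Q pt w V Z =
     {z \<in> Z. \<forall>e\<in>E. \<forall>u\<in>V e. \<forall>v\<in>V e. compat_form K Q pt w e (z \<circ> X e) u v = 0}"

text \<open>The Hessian of the material at the identity does not depend on the cell when
  \<open>c1 e + c2 e\<close> does not; it is written here with the parameters of the cell at hand.\<close>

definition margin ::
  "'e set \<Rightarrow> ('e \<Rightarrow> (real^3) set) \<Rightarrow> ('e \<Rightarrow> real^3 \<Rightarrow> real^3)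
    \<Rightarrow> ('e \<Rightarrow> 'q set) \<Rightarrow> ('e \<Rightarrow> 'q \<Rightarrow> real^3) \<Rightarrow> ('e \<Rightarrow> real) \<Rightarrow> ('e \<Rightarrow> real)
    \<Rightarrow> (real^3 \<Rightarrow> real^3) \<Rightarrow> real"
where
  "margin E K X Q pt c1 c2 z =
     (MIN (e, q)\<in>Sigma E Q. INF H\<in>- {0}.
        (hessian (W_iso (c1 e) (c2 e)) (mat 1) H H
          + frob (phys_grad K X z e (pt e q)) (tcross H H)) / refform H H)"

definition max_loss ::
  "'e set \<Rightarrow> ('e \<Rightarrow> (real^3) set) \<Rightarrow> ('e \<Rightarrow> real^3 \<Rightarrow> real^3)
    \<Rightarrow> ('e \<Rightarrow> 'q set) \<Rightarrow> ('e \<Rightarrow> 'q \<Rightarrow> real^3) \<Rightarrow> real \<Rightarrow> (real^3 \<Rightarrow> real^3) \<Rightarrow> real"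
where
  "max_loss E K X Q pt c z =
     (MAX (e, q)\<in>Sigma E Q. coeff_loss (phys_grad K X z e (pt e q) - (2 * c) *\<^sub>R mat 1))"

text \<open>Parent cells \<open>K e\<close> are closed convex polytopes. Two cells meet in the image of a
  (possibly empty) face of each parent, and the two parametrisations of the shared face
  agree up to an affine identification \<open>\<iota>\<close> of the parent faces.\<close>

locale mesh =
  fixes \<Omega> :: "(real^3) set"
    and E :: "'e set"
    and K :: "'e \<Rightarrow> (real^3) set"
    and X :: "'e \<Rightarrow> real^3 \<Rightarrow> real^3"
  assumes domain: "connected \<Omega>" "bounded \<Omega>" "lipschitz_domain \<Omega>"
    and finite_cells: "finite E"
    and parent: "\<And>e. e \<in> E \<Longrightarrow> polytope (K e)" "\<And>e. e \<in> E \<Longrightarrow> interior (K e) \<noteq> {}"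
    and cover: "closure \<Omega> = (\<Union>e\<in>E. X e ` K e)"
    and nonoverlap: "\<And>e e'. e \<in> E \<Longrightarrow> e' \<in> E \<Longrightarrow> e \<noteq> e' \<Longrightarrow>
           interior (X e ` K e) \<inter> interior (X e' ` K e') = {}"
    and conforming: "\<And>e e'. e \<in> E \<Longrightarrow> e' \<in> E \<Longrightarrow> e \<noteq> e' \<Longrightarrow>
           \<exists>F F' A b. F face_of K e \<and> F' face_of K e' \<and>
             (let \<iota> = (\<lambda>\<xi>. A *v \<xi> + b) in
               bij_betw \<iota> F F' \<and> (\<forall>\<xi>\<in>F. X e' (\<iota> \<xi>) = X e \<xi>)) \<and>
             X e ` K e \<inter> X e' ` K e' = X e ` F"
    and map_inj: "\<And>e. e \<in> E \<Longrightarrow> inj_on (X e) (K e)"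
    and map_diff: "\<And>e. e \<in> E \<Longrightarrow> X e differentiable_on K e"
    and map_orient: "\<And>e \<xi>. e \<in> E \<Longrightarrow> \<xi> \<in> K e \<Longrightarrow> det (Dcell (K e) (X e) \<xi>) > 0"
    and map_bounded: "\<And>e. e \<in> E \<Longrightarrow> bounded (Dcell (K e) (X e) ` K e)"
    and map_inv_bounded: "\<And>e. e \<in> E \<Longrightarrow> bounded ((\<lambda>\<xi>. matrix_inv (Dcell (K e) (X e) \<xi>)) ` K e)"

text \<open>Fields are total functions; only their values on \<open>K e\<close>, respectively on
  \<open>closure \<Omega>\<close>, matter. The assumption \<open>compat_integrable\<close> says that the compatibility
  forms are well defined. The quadrature weights are arbitrary reals and hence no parameter.\<close>

locale discretisation = mesh \<Omega> E K X
  for \<Omega> :: "(real^3) set" and E :: "'e set" and K :: "'e \<Rightarrow> (real^3) set"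
    and X :: "'e \<Rightarrow> real^3 \<Rightarrow> real^3" +
  fixes Q :: "'e \<Rightarrow> 'q set"
    and pt :: "'e \<Rightarrow> 'q \<Rightarrow> real^3"
    and V :: "'e \<Rightarrow> (real^3 \<Rightarrow> real^3) set"
    and Z :: "(real^3 \<Rightarrow> real^3) set"
    and c1 c2 :: "'e \<Rightarrow> real"
    and c :: real
  assumes quad_points: "\<And>e. e \<in> E \<Longrightarrow> finite (Q e)" "\<And>e. e \<in> E \<Longrightarrow> Q e \<noteq> {}"
      "\<And>e q. e \<in> E \<Longrightarrow> q \<in> Q e \<Longrightarrow> pt e q \<in> K e"
    and variations: "\<And>e. e \<in> E \<Longrightarrow> fields.subspace (V e)"
      "\<And>e u. e \<in> E \<Longrightarrow> u \<in> V e \<Longrightarrow> u differentiable_on K e"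
    and candidates: "fields.subspace Z" "\<exists>B. finite B \<and> Z = fields.span B"
    and candidates_cont: "\<And>z. z \<in> Z \<Longrightarrow> continuous_on (closure \<Omega>) z"
    and candidates_diff: "\<And>z e. z \<in> Z \<Longrightarrow> e \<in> E \<Longrightarrow> (z \<circ> X e) differentiable_on K e"
    and candidates_const: "\<And>a. \<exists>z\<in>Z. \<forall>x\<in>closure \<Omega>. z x = a"
    and compat_integrable: "\<And>z e u v. z \<in> Z \<Longrightarrow> e \<in> E \<Longrightarrow> u \<in> V e \<Longrightarrow> v \<in> V e \<Longrightarrow>
           set_integrable lebesgue (K e) (compat_integrand (K e) (z \<circ> X e) u v)"
    and material: "\<And>e. e \<in> E \<Longrightarrow> c1 e \<ge> 0" "\<And>e. e \<in> E \<Longrightarrow> c2 e \<ge> 0"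
      "\<And>e. e \<in> E \<Longrightarrow> c1 e + c2 e = c" "c > 0"

end

theory Submission
  imports Defs
begin

text \<open>Expanding the material at the identity gives
  \<open>D\<^sup>2W(I)[H, H] = c (\<A>[H, H] - 2 I : (H \<times> H))\<close>, so every quotient in the margin is \<open>c\<close> minus
  a quotient of the coefficient loss at \<open>R - 2 c I\<close>. Up to a factor, the loss dominates
  the absolute value of every entry of its argument, because some \<open>H\<close> of rank two has a single nonzero
  cofactor; in particular it is nonnegative. Hence the maximal loss is a continuous coercive function
  of the finite tuple of gradients. These tuples form a linear, hence closed, subspace of a
  finite-dimensional space, so the minimum is attained. At \<open>z = 0\<close> the loss is at most \<open>c\<close>,
  since \<open>D\<^sup>2W(I)\<close> is positive semidefinite.\<close>

section \<open>The material Hessian at the identity\<close>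

lemma frob_eq_inner: "frob A B = A \<bullet> B"
  by (simp add: frob_def trace_def transpose_def matrix_matrix_mult_def inner_vec_def sum_3)

lemma tcross_self: "tcross H H = 2 *\<^sub>R cof H"
  by (simp add: tcross_def cof_def vec_eq_iff algebra_simps)

lemma tcross_commute: "tcross A B = tcross B A"
  by (simp add: tcross_def add.commute)

lemma bounded_bilinear_tcross: "bounded_bilinear tcross"
  unfolding bilinear_conv_bounded_bilinear[symmetric]
  by (auto simp: bilinear_def tcross_def cof_def vec_eq_iff algebra_simps intro!: linearI)

text \<open>\<open>cof\<close> is half the diagonal of the symmetric bilinear map
  \<open>tcross\<close>, so the product rule yields two equal halves.\<close>

lemma has_derivative_cof: "(cof has_derivative tcross F) (at F)"
proof -
  have eq: "cof = (\<lambda>F. (1 / 2) *\<^sub>R tcross F F)"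
    by (simp add: tcross_self)
  have "((\<lambda>F. (1 / 2) *\<^sub>R tcross F F) has_derivative
      (\<lambda>L. (1 / 2) *\<^sub>R (tcross F L + tcross L F))) (at F)"
    by (intro has_derivative_scaleR_right bounded_bilinear.FDERIV[OF bounded_bilinear_tcross]
        has_derivative_ident)
  moreover have "(1 / 2) *\<^sub>R (tcross F L + tcross L F) = tcross F L" for L
    by (simp add: tcross_commute[of L F] scaleR_2[symmetric])
  ultimately show ?thesis
    by (simp add: eq)
qed

text \<open>Euler's identity for the cubic form \<open>det\<close> reads
  \<open>cof F \<bullet> F = 3 * det F\<close>. Since \<open>tcross F L \<bullet> F\<close> equals
  \<open>2 * (cof F \<bullet> L)\<close>, the two terms of the product rule combine.\<close>

lemma has_derivative_det_3: "(det has_derivative (\<lambda>L. cof F \<bullet> L)) (at (F :: real^3^3))"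
proof -
  \<comment> \<open>The cyclic indices \<open>i + 1\<close> and \<open>i + 2\<close> produce the
    numerals 4 and 5, which must be reduced modulo 3.\<close>
  have arith: "(4::3) = 1" "(5::3) = 2"
    by simp_all
  have eq: "det = (\<lambda>F :: real^3^3. (1 / 3) * (cof F \<bullet> F))"
    by (simp add: fun_eq_iff det_3 cof_def inner_vec_def sum_3 arith algebra_simps)
  have "((\<lambda>F. (1 / 3) * (cof F \<bullet> F)) has_derivative
      (\<lambda>L. (1 / 3) * (cof F \<bullet> L + tcross F L \<bullet> F))) (at F)"
    by (intro has_derivative_mult_right has_derivative_inner has_derivative_cof
        has_derivative_ident)
  moreover have "(1 / 3) * (cof F \<bullet> L + tcross F L \<bullet> F) = cof F \<bullet> L" for L
    by (simp add: tcross_def cof_def inner_vec_def sum_3 arith algebra_simps)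
  ultimately show ?thesis
    by (simp add: eq)
qed

lemma has_derivative_det_powr:
  assumes "det (F :: real^3^3) > 0"
  shows "((\<lambda>F. det F powr p) has_derivative (\<lambda>L. p * det F powr (p - 1) * (cof F \<bullet> L))) (at F)"
proof -
  have "((\<lambda>x. x powr p) has_real_derivative p * det F powr (p - 1)) (at (det F))"
    using assms by (rule has_real_derivative_powr)
  from DERIV_compose_FDERIV[OF this has_derivative_det_3[of F]] show ?thesis
    by (simp add: mult_ac)
qed

lemmas material_derivative_intros = has_derivative_add has_derivative_diff has_derivative_mult
  has_derivative_inner has_derivative_det_powr has_derivative_cof
  has_derivative_const has_derivative_ident bounded_bilinear.FDERIV[OF bounded_bilinear_tcross]

lemma frechet_derivative_W_iso:
  assumes "det F > 0"
  shows "frechet_derivative (W_iso a b) (at F) L =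
    a * (- 2 / 3 * det F powr (- 2 / 3 - 1) * (cof F \<bullet> L) * (F \<bullet> F)
         + det F powr (- 2 / 3) * (2 * (F \<bullet> L)))
    + b * (- 4 / 3 * det F powr (- 4 / 3 - 1) * (cof F \<bullet> L) * (cof F \<bullet> cof F)
         + det F powr (- 4 / 3) * (2 * (cof F \<bullet> tcross F L)))" (is "_ = ?D L")
proof -
  have "(W_iso a b has_derivative ?D) (at F)"
    unfolding W_iso_def[abs_def] frob_eq_inner
    by (rule has_derivative_eq_rhs, (rule material_derivative_intros assms)+)
       (auto simp: fun_eq_iff inner_commute algebra_simps)
  from frechet_derivative_at[OF this, symmetric] show ?thesis
    by (simp only:)
qed

lemma refform_self: "refform H H = 2 * (H \<bullet> H) + 2 / 3 * (trace H)\<^sup>2"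
  by (simp add: refform_def frob_eq_inner power2_eq_square)

text \<open>At the identity the two isochoric invariants have the same second-order form, so the
  parameters enter only through their sum. This is where independence of the cell comes
  from.\<close>

lemma hessian_W_iso:
  "hessian (W_iso a b) (mat 1) H H = (a + b) * (refform H H - 2 * frob (mat 1) (tcross H H))"
proof -
  define g where "g F =
    a * (- 2 / 3 * det F powr (- 2 / 3 - 1) * (cof F \<bullet> H) * (F \<bullet> F)
         + det F powr (- 2 / 3) * (2 * (F \<bullet> H)))
    + b * (- 4 / 3 * det F powr (- 4 / 3 - 1) * (cof F \<bullet> H) * (cof F \<bullet> cof F)
         + det F powr (- 4 / 3) * (2 * (cof F \<bullet> tcross F H)))" for F
  let ?I = "mat 1 :: real^3^3"
  have arith: "(4::3) = 1" "(5::3) = 2"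
    by simp_all
  have pos: "det ?I > 0"
    by simp
  have cof_I: "cof ?I = ?I"
    by (simp add: vec_eq_iff forall_3 cof_def mat_def arith)
  have tcross_zero: "tcross F 0 = 0" for F
    using bounded_bilinear.zero_right[OF bounded_bilinear_tcross] .
  have inner_I: "?I \<bullet> A = trace A" "A \<bullet> ?I = trace A" for A
    by (simp_all add: inner_vec_def mat_def trace_def sum_3)
  have trace_I: "trace ?I = 3"
    by (simp add: trace_def mat_def sum_3)
  have tcross_I: "tcross ?I H = trace H *\<^sub>R ?I - transpose H"
    by (simp add: vec_eq_iff forall_3 tcross_def cof_def mat_def transpose_def trace_def sum_3
        arith algebra_simps)
  have inner_tcross_I: "tcross ?I H \<bullet> H = trace (tcross H H)"
    "tcross ?I H \<bullet> tcross ?I H = (trace H)\<^sup>2 + H \<bullet> H"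
    "trace (tcross ?I H) = 2 * trace H"
    unfolding tcross_I
    by (simp_all add: tcross_self cof_def mat_def transpose_def trace_def inner_vec_def sum_3
        arith power2_eq_square algebra_simps)
  \<comment> \<open>The claim concerns \<open>g'\<close> only through its value at \<open>H\<close>,
    so \<open>g'\<close> stays existential and is assembled by the differentiation rules.\<close>
  have "\<exists>g'. (g has_derivative g') (at ?I) \<and>
      g' H = (a + b) * (refform H H - 2 * frob (mat 1) (tcross H H))"
    unfolding g_def[abs_def]
    by (rule exI, rule conjI, (rule material_derivative_intros pos)+)
       (simp add: cof_I inner_I trace_I inner_tcross_I refform_self frob_eq_inner
         tcross_commute[of H "mat 1"] tcross_zero power2_eq_square algebra_simps)
  then obtain g' where g': "(g has_derivative g') (at ?I)"
    and g'H: "g' H = (a + b) * (refform H H - 2 * frob (mat 1) (tcross H H))"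
    by blast
  \<comment> \<open>The formula \<open>g\<close> for the first derivative is justified where
    \<open>det F > 0\<close>. Openness of this set allows differentiating it once more at the
    identity.\<close>
  have "continuous_on UNIV (det :: real^3^3 \<Rightarrow> real)"
    by (intro continuous_at_imp_continuous_on ballI has_derivative_continuous[OF has_derivative_det_3])
  then have "open {F :: real^3^3. det F > 0}"
    by (intro open_Collect_less continuous_on_const)
  moreover have "g F = frechet_derivative (W_iso a b) (at F) H" if "det F > 0" for F
    using frechet_derivative_W_iso[OF that] by (simp add: g_def)
  ultimately have "((\<lambda>F. frechet_derivative (W_iso a b) (at F) H) has_derivative g') (at ?I)"
    using has_derivative_transform_within_open[OF g', of "{F. det F > 0}"] pos by simp
  from frechet_derivative_at[OF this, symmetric] have "hessian (W_iso a b) ?I H H = g' H"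
    by (simp add: hessian_def)
  with g'H show ?thesis
    by simp
qed

section \<open>The coefficient loss\<close>

lemma refform_ge: "refform H H \<ge> (norm H)\<^sup>2"
  using zero_le_power2[of "norm H"] zero_le_power2[of "trace H"]
  unfolding refform_self dot_square_norm by linarith

lemma refform_pos: "H \<noteq> 0 \<Longrightarrow> refform H H > 0"
  by (rule less_le_trans[OF _ refform_ge]) simp

text \<open>The numerator is quadratic in \<open>H\<close> and \<open>refform\<close> dominates the
  squared norm, so the bound is uniform in \<open>H\<close> and linear in the norm of
  \<open>U\<close>. It makes the supremum finite and later supplies the Lipschitz constant.\<close>

lemma coeff_quotient_bound:
  "\<exists>C\<ge>0. \<forall>U H. H \<noteq> 0 \<longrightarrow> - frob U (tcross H H) / refform H H \<le> C * norm U"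
proof -
  obtain C where C: "C > 0" "\<And>A B. norm (tcross A B) \<le> norm A * norm B * C"
    using bounded_bilinear.pos_bounded[OF bounded_bilinear_tcross] by blast
  have "- frob U (tcross H H) / refform H H \<le> C * norm U" if "H \<noteq> 0" for U H
  proof -
    have "- frob U (tcross H H) \<le> norm U * norm (tcross H H)"
      using norm_cauchy_schwarz[of "- U" "tcross H H"] by (simp add: frob_eq_inner)
    also have "\<dots> \<le> norm U * (norm H * norm H * C)"
      by (intro mult_left_mono C) auto
    also have "\<dots> = C * norm U * (norm H)\<^sup>2"
      by (simp add: power2_eq_square)
    also have "\<dots> \<le> C * norm U * refform H H"
      using refform_ge[of H] C(1) by (intro mult_left_mono) auto
    finally show ?thesis
      unfolding pos_divide_le_eq[OF refform_pos[OF that]] .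
  qed
  with C(1) show ?thesis
    by (intro exI[of _ C]) auto
qed

lemma bdd_above_coeff_quotient:
  "bdd_above ((\<lambda>H. - frob U (tcross H H) / refform H H) ` (- {0}))"
proof -
  obtain C where "\<forall>U H. H \<noteq> 0 \<longrightarrow> - frob U (tcross H H) / refform H H \<le> C * norm U"
    using coeff_quotient_bound by blast
  then show ?thesis
    by (intro bdd_aboveI2[where M = "C * norm U"]) simp
qed

lemma coeff_loss_upper:
  "H \<noteq> 0 \<Longrightarrow> - frob U (tcross H H) / refform H H \<le> coeff_loss U"
  unfolding coeff_loss_def by (intro cSUP_upper bdd_above_coeff_quotient) auto

lemma Compl_zero_matrix_nonempty: "- {0 :: real^3^3} \<noteq> {}"
proof -
  have "(mat 1 :: real^3^3) \<in> - {0}"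
    by (simp add: mat_def vec_eq_iff exI[of _ 1])
  then show ?thesis by blast
qed

lemma coeff_loss_least:
  "(\<And>H. H \<noteq> 0 \<Longrightarrow> - frob U (tcross H H) / refform H H \<le> m) \<Longrightarrow> coeff_loss U \<le> m"
  unfolding coeff_loss_def using Compl_zero_matrix_nonempty by (intro cSUP_least) auto

text \<open>The loss is a supremum of functions that are linear in \<open>U\<close>.\<close>

lemma coeff_loss_add_le: "coeff_loss (U + V) \<le> coeff_loss U + coeff_loss V"
proof (rule coeff_loss_least)
  fix H :: "real^3^3" assume H: "H \<noteq> 0"
  have "- frob (U + V) (tcross H H) / refform H H =
      - frob U (tcross H H) / refform H H + - frob V (tcross H H) / refform H H"
    by (simp add: frob_eq_inner inner_add_left add_divide_distrib diff_divide_distrib)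
  also have "\<dots> \<le> coeff_loss U + coeff_loss V"
    by (intro add_mono coeff_loss_upper H)
  finally show "- frob (U + V) (tcross H H) / refform H H \<le> coeff_loss U + coeff_loss V" .
qed

text \<open>Subadditivity, applied to \<open>V + (U - V)\<close> and to \<open>U + (V - U)\<close>,
  together with the linear bound makes the loss globally Lipschitz.\<close>

lemma tendsto_coeff_loss:
  assumes "(U \<longlongrightarrow> A) F"
  shows "((\<lambda>n. coeff_loss (U n)) \<longlongrightarrow> coeff_loss A) F"
proof -
  obtain C where "C \<ge> 0" and
    C: "\<forall>U H. H \<noteq> 0 \<longrightarrow> - frob U (tcross H H) / refform H H \<le> C * norm U"
    using coeff_quotient_bound by blast
  have le: "coeff_loss U \<le> C * norm U" for U
    using C by (intro coeff_loss_least) blast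
  have "\<bar>coeff_loss U - coeff_loss V\<bar> \<le> C * norm (U - V)" for U V
    using coeff_loss_add_le[of V "U - V"] le[of "U - V"]
      coeff_loss_add_le[of U "V - U"] le[of "V - U"] by (simp add: norm_minus_commute)
  then have "C-lipschitz_on UNIV coeff_loss"
    using \<open>C \<ge> 0\<close> by (intro lipschitz_onI) (auto simp: dist_norm)
  then have "isCont coeff_loss A"
    using lipschitz_on_continuous_on continuous_on_eq_continuous_at open_UNIV by blast
  then show ?thesis
    using assms by (rule isCont_tendsto_compose)
qed

text \<open>The test direction has a single nonvanishing cofactor, of prescribed sign, at \<open>(m, n)\<close>.\<close>

lemma abs_entry_le_coeff_loss: "\<bar>U $ m $ n\<bar> \<le> 10 / 3 * coeff_loss U"
proof -
  have arith: "(4::3) = 1" "(5::3) = 2"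
    by simp_all
  \<comment> \<open>The sign is opposite to that of the entry, so
    \<open>- U : (H \<times> H)\<close> becomes twice the absolute value of the entry.\<close>
  define s :: real where "s = (if U $ m $ n > 0 then - 1 else 1)"
  define H :: "real^3^3" where "H = (\<chi> i j. if i = m + 1 \<and> j = n + 1 then 1
     else if i = m + 2 \<and> j = n + 2 then s else 0)"
  have s2: "s * s = 1"
    by (simp add: s_def)
  have "H $ (m + 1) $ (n + 1) = 1"
    by (simp add: H_def)
  then have H0: "H \<noteq> 0"
    by auto
  have "cof H = axis m (axis n s)"
    using exhaust_3[of m] exhaust_3[of n]
    by (elim disjE) (simp_all add: vec_eq_iff forall_3 cof_def H_def axis_def arith)
  then have num: "- frob U (tcross H H) = 2 * \<bar>U $ m $ n\<bar>"
    by (simp add: tcross_self frob_eq_inner inner_axis s_def)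
  have "H \<bullet> H = 2"
    using exhaust_3[of m] exhaust_3[of n] s2
    by (elim disjE) (simp_all add: inner_vec_def sum_3 H_def arith)
  moreover have "\<bar>trace H\<bar> \<le> 2"
    using exhaust_3[of m] exhaust_3[of n]
    by (elim disjE) (simp_all add: trace_def sum_3 H_def arith s_def)
  then have "(trace H)\<^sup>2 \<le> 4"
    using abs_le_square_iff[of "trace H" 2] by simp
  \<comment> \<open>\<open>2 * 2 + 2 / 3 * 4 = 20 / 3\<close>; divided by the factor 2 of the
    numerator this is the constant \<open>10 / 3\<close>.\<close>
  ultimately have "refform H H \<le> 20 / 3"
    by (simp add: refform_self)
  then have "2 * \<bar>U $ m $ n\<bar> / (20 / 3) \<le> - frob U (tcross H H) / refform H H"
    unfolding num using refform_pos[OF H0] by (intro divide_left_mono) auto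
  also have "\<dots> \<le> coeff_loss U"
    by (rule coeff_loss_upper[OF H0])
  finally show ?thesis
    by simp
qed

lemma coeff_loss_nonneg: "coeff_loss U \<ge> 0"
  using abs_entry_le_coeff_loss[of U 1 1] by simp

lemma coeff_loss_neg_identity:
  assumes "c \<ge> 0"
  shows "coeff_loss (- (2 * c) *\<^sub>R mat 1) \<le> c"
proof (rule coeff_loss_least)
  fix H :: "real^3^3" assume H: "H \<noteq> 0"
  have arith: "(4::3) = 1" "(5::3) = 2"
    by simp_all
  \<comment> \<open>The squares involve differences of diagonal entries and symmetrised off-diagonal
    entries, so the form vanishes exactly on sums of a multiple of the identity and a skew
    matrix.\<close>
  have "refform H H - 2 * frob (mat 1) (tcross H H) =
      2 / 3 * ((H$1$1 - H$2$2)\<^sup>2 + (H$2$2 - H$3$3)\<^sup>2 + (H$3$3 - H$1$1)\<^sup>2) * 2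
      + 2 * ((H$1$2 + H$2$1)\<^sup>2 + (H$2$3 + H$3$2)\<^sup>2 + (H$3$1 + H$1$3)\<^sup>2)"
    by (simp add: refform_self tcross_self frob_eq_inner cof_def mat_def inner_vec_def
        trace_def sum_3 arith power2_eq_square algebra_simps)
  also have "\<dots> \<ge> 0"
    by (intro add_nonneg_nonneg mult_nonneg_nonneg) auto
  finally have "2 * frob (mat 1) (tcross H H) \<le> refform H H"
    by simp
  then have "c * (2 * frob (mat 1) (tcross H H)) \<le> c * refform H H"
    using assms by (rule mult_left_mono)
  then show "- frob (- (2 * c) *\<^sub>R mat 1) (tcross H H) / refform H H \<le> c"
    using refform_pos[OF H] by (simp add: pos_divide_le_eq frob_eq_inner mult_ac)
qed

text \<open>Division by \<open>refform H H\<close> turns the leading term into the constant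
  \<open>k\<close>, and what remains is the negated loss quotient. The infimum of
  \<open>k - ?g H\<close> is \<open>k\<close> minus the supremum of \<open>?g\<close>.\<close>

lemma INF_quotient_eq:
  "(INF H\<in>- {0}. (k * (refform H H - 2 * frob (mat 1) (tcross H H))
      + frob R (tcross H H)) / refform H H)
    = k - coeff_loss (R - (2 * k) *\<^sub>R mat 1)" (is "(INF H\<in>_. ?f H) = _")
proof -
  let ?g = "\<lambda>H. - frob (R - (2 * k) *\<^sub>R mat 1) (tcross H H) / refform H H"
  have eq: "?f H = k - ?g H" if "H \<in> - {0}" for H
    using refform_pos[of H] that
    by (simp add: frob_eq_inner inner_diff_left inner_add_left field_simps)
  show ?thesis
  proof (rule antisym)
    have "coeff_loss (R - (2 * k) *\<^sub>R mat 1) \<le> k - (INF H\<in>- {0}. ?f H)"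
    proof (rule coeff_loss_least)
      fix H :: "real^3^3" assume "H \<noteq> 0"
      have "bdd_below (?f ` (- {0}))"
      proof (rule bdd_belowI2)
        fix H :: "real^3^3" assume "H \<in> - {0}"
        then show "k - coeff_loss (R - (2 * k) *\<^sub>R mat 1) \<le> ?f H"
          unfolding eq[OF \<open>H \<in> - {0}\<close>] by (intro diff_left_mono coeff_loss_upper) simp
      qed
      then have "(INF H\<in>- {0}. ?f H) \<le> ?f H"
        using \<open>H \<noteq> 0\<close> by (intro cINF_lower) auto
      then show "?g H \<le> k - (INF H\<in>- {0}. ?f H)"
        using eq[of H] \<open>H \<noteq> 0\<close> by simp
    qed
    then show "(INF H\<in>- {0}. ?f H) \<le> k - coeff_loss (R - (2 * k) *\<^sub>R mat 1)"
      by simp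
    show "k - coeff_loss (R - (2 * k) *\<^sub>R mat 1) \<le> (INF H\<in>- {0}. ?f H)"
    proof (rule cINF_greatest[OF Compl_zero_matrix_nonempty])
      fix H :: "real^3^3" assume "H \<in> - {0}"
      then show "k - coeff_loss (R - (2 * k) *\<^sub>R mat 1) \<le> ?f H"
        unfolding eq[OF \<open>H \<in> - {0}\<close>] by (intro diff_left_mono coeff_loss_upper) simp
    qed
  qed
qed

section \<open>Derivatives within convex sets\<close>

text \<open>Quadrature points may lie on the boundary of a parent cell. The difference
  \<open>D\<close> of two derivatives is a derivative of the zero function; along segments from
  \<open>x\<close> into \<open>K\<close> it must vanish, and an interior ball provides enough
  segments to reach every direction.\<close>

lemma has_derivative_within_convex_unique:
  fixes f :: "'a::real_normed_vector \<Rightarrow> 'b::real_normed_vector"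
  assumes K: "convex K" "interior K \<noteq> {}" "x \<in> K"
    and f': "(f has_derivative f') (at x within K)"
    and f'': "(f has_derivative f'') (at x within K)"
  shows "f' = f''"
proof -
  define D where "D h = f' h - f'' h" for h
  have D: "((\<lambda>_. 0) has_derivative D) (at x within K)"
    using has_derivative_diff[OF f' f''] by (simp add: D_def[abs_def])
  then interpret D: bounded_linear D
    by (rule has_derivative_bounded_linear)
  have D0: "D (y - x) = 0" if "y \<in> K" for y
  proof -
    define p where "p t = x + t *\<^sub>R (y - x)" for t :: real
    have "p t = (1 - t) *\<^sub>R x + t *\<^sub>R y" for t
      by (simp add: p_def algebra_simps)
    then have "p ` {0..1} \<subseteq> K"
      using K(1,3) that by (auto simp: convex_alt)
    moreover have "p 0 = x"
      by (simp add: p_def)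
    ultimately have "((\<lambda>_. 0) has_derivative D) (at (p 0) within p ` {0..1})"
      using D by (auto intro: has_derivative_subset)
    moreover have "(p has_derivative (\<lambda>t. t *\<^sub>R (y - x))) (at 0 within {0..1})"
      unfolding p_def by (auto intro!: derivative_eq_intros)
    ultimately have "((\<lambda>_. 0) has_derivative (\<lambda>t. D (t *\<^sub>R (y - x)))) (at 0 within {0..1})"
      using has_derivative_in_compose by blast
    then have "((\<lambda>_. 0) has_vector_derivative D (y - x)) (at (0::real) within cbox 0 1)"
      by (simp add: has_vector_derivative_def D.scaleR)
    moreover have "((\<lambda>_. 0) has_vector_derivative (0::'b)) (at (0::real) within cbox 0 1)"
      by (rule has_vector_derivative_const)
    ultimately show ?thesis
      by (intro vector_derivative_unique_within_closed_interval[where a = 0 and b = "1::real"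
            and x = 0 and f = "\<lambda>_. 0"]) auto
  qed
  obtain p r where r: "r > 0" "ball p r \<subseteq> K"
    using K(2) by (metis all_not_in_conv mem_interior)
  have "D v = 0" for v
  proof -
    \<comment> \<open>A multiple of \<open>v\<close> is the difference of two points of the ball.
      The summand 1 keeps the denominator positive for \<open>v = 0\<close>.\<close>
    define t where "t = r / (2 * (norm v + 1))"
    have v1: "norm v + 1 > 0"
      using norm_ge_zero[of v] by linarith
    have t: "t > 0"
      using r(1) v1 by (simp add: t_def)
    have "t * norm v \<le> t * (norm v + 1)"
      using t by simp
    also have "\<dots> = r / 2"
      using v1 by (simp add: t_def field_simps)
    also have "\<dots> < r"
      using r(1) by simp
    finally have "p + t *\<^sub>R v \<in> ball p r"
      using t by (simp add: dist_norm)
    then have "D (p + t *\<^sub>R v - x) = 0" "D (p - x) = 0"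
      using r by (auto intro!: D0)
    then have "D (p + t *\<^sub>R v - x - (p - x)) = 0"
      by (simp only: D.diff) simp
    then show "D v = 0"
      using t by (simp add: D.scaleR)
  qed
  then show ?thesis
    by (simp add: D_def fun_eq_iff)
qed

text \<open>\<open>jacobian\<close> rests on a chosen derivative, so its linearity is a consequence
  of uniqueness. The form \<open>f + r g\<close> treats sums and multiples together.\<close>

lemma jacobian_within_convex_linear:
  fixes f g :: "real^'n \<Rightarrow> real^'m"
  assumes K: "convex K" "interior K \<noteq> {}" "x \<in> K"
    and f: "f differentiable (at x within K)" and g: "g differentiable (at x within K)"
  shows "jacobian (\<lambda>y. f y + r *\<^sub>R g y) (at x within K)
       = jacobian f (at x within K) + r *\<^sub>R jacobian g (at x within K)"
proof -
  let ?f' = "frechet_derivative f (at x within K)" and ?g' = "frechet_derivative g (at x within K)"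
  have D: "((\<lambda>y. f y + r *\<^sub>R g y) has_derivative (\<lambda>h. ?f' h + r *\<^sub>R ?g' h)) (at x within K)"
    using f g by (intro has_derivative_add has_derivative_scaleR_right)
      (auto simp: frechet_derivative_works)
  then have "(\<lambda>y. f y + r *\<^sub>R g y) differentiable (at x within K)"
    by (rule differentiableI)
  then have "frechet_derivative (\<lambda>y. f y + r *\<^sub>R g y) (at x within K) =
      (\<lambda>h. ?f' h + r *\<^sub>R ?g' h)"
    using has_derivative_within_convex_unique[OF K _ D] by (simp add: frechet_derivative_works)
  then show ?thesis
    by (simp add: jacobian_def matrix_def vec_eq_iff)
qed

section \<open>Coercive minimisation over linear families\<close>

text \<open>Bolzano-Weierstrass, one coordinate at a time: each further subsequence keeps the limits
  already obtained.\<close>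

lemma pointwise_bounded_convergent_subsequence:
  fixes s :: "nat \<Rightarrow> 'i \<Rightarrow> 'a::heine_borel"
  assumes "finite I" and "\<And>i. i \<in> I \<Longrightarrow> bounded (range (\<lambda>n. s n i))"
  shows "\<exists>r. strict_mono r \<and> (\<forall>i\<in>I. convergent (\<lambda>n. s (r n) i))"
  using assms
proof (induction I rule: finite_induct)
  case empty
  show ?case
    by (intro exI[of _ id]) (simp add: strict_mono_def)
next
  case (insert i I)
  then obtain r where r: "strict_mono r" "\<And>j. j \<in> I \<Longrightarrow> convergent (\<lambda>n. s (r n) j)"
    by auto
  have "bounded (range (\<lambda>n. s (r n) i))"
    using insert.prems[of i] by (rule bounded_subset) auto
  then obtain l r' where r': "strict_mono r'" "((\<lambda>n. s (r n) i) \<circ> r') \<longlonglongrightarrow> l"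
    using bounded_imp_convergent_subsequence by blast
  have "convergent (\<lambda>n. s ((r \<circ> r') n) j)" if "j \<in> insert i I" for j
  proof (cases "j = i")
    case True
    then show ?thesis
      using r'(2) by (auto simp: convergent_def o_def)
  next
    case False
    then have "convergent ((\<lambda>n. s (r n) j) \<circ> r')"
      using that r(2) r'(1) by (intro convergent_subseq_convergent) auto
    then show ?thesis
      by (simp add: o_def)
  qed
  then show ?case
    using strict_mono_o[OF r(1) r'(1)] by blast
qed

text \<open>Induction on the coordinates: either all members of \<open>L\<close> vanish at the new coordinate,
  or a member equal to 1 there reduces the claim to the subfamily vanishing there.\<close>

lemma linear_family_closed:
  fixes L :: "('i \<Rightarrow> real) set"
  assumes "finite I"
    and "\<And>f g r. f \<in> L \<Longrightarrow> g \<in> L \<Longrightarrow> (\<lambda>i. f i + r * g i) \<in> L"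
    and "\<And>n. s n \<in> L" and "\<And>i. i \<in> I \<Longrightarrow> (\<lambda>n. s n i) \<longlonglongrightarrow> g i"
  shows "\<exists>f\<in>L. \<forall>i\<in>I. f i = g i"
  using assms
proof (induction I arbitrary: L s g rule: finite_induct)
  case empty
  then show ?case
    by blast
next
  case (insert i I)
  note lin = insert.prems(1) and s = insert.prems(2) and lim = insert.prems(3)
  show ?case
  proof (cases "\<forall>f\<in>L. f i = 0")
    case True
    then have "(\<lambda>n. s n i) = (\<lambda>n. 0)"
      using s by blast
    then have "g i = 0"
      using lim[of i] by (simp add: LIMSEQ_const_iff)
    moreover have "\<exists>f\<in>L. \<forall>j\<in>I. f j = g j"
      by (rule insert.IH[OF lin s]) (auto intro: lim)
    ultimately show ?thesis
      using True by auto
  next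
    case False
    then obtain f where f: "f \<in> L" "f i \<noteq> 0"
      by blast
    have zero: "(\<lambda>_. 0) \<in> L"
      using lin[OF f(1) f(1), of "-1"] by simp
    define h where "h j = f j / f i" for j
    have h: "h \<in> L" "h i = 1"
      using lin[OF zero f(1), of "1 / f i"] f(2) by (simp_all add: h_def[abs_def])
    define L0 where "L0 = {f \<in> L. f i = 0}"
    \<comment> \<open>Subtracting \<open>s n i\<close> times \<open>h\<close> moves the sequence
      into \<open>L0\<close>; adding back \<open>g i\<close> times \<open>h\<close> afterwards
      restores the limit.\<close>
    have "\<exists>f\<in>L0. \<forall>j\<in>I. f j = g j - g i * h j"
    proof (rule insert.IH[where s = "\<lambda>n j. s n j + (- s n i) * h j"])
      show "(\<lambda>j. f j + r * g j) \<in> L0" if "f \<in> L0" "g \<in> L0" for f g r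
        using that lin by (simp add: L0_def)
      show "(\<lambda>j. s n j + (- s n i) * h j) \<in> L0" for n
        using lin[OF s h(1), of n "- s n i"] h(2) by (simp add: L0_def)
      show "(\<lambda>n. s n j + (- s n i) * h j) \<longlonglongrightarrow> g j - g i * h j" if "j \<in> I" for j
        using that by (auto intro!: tendsto_eq_intros lim)
    qed
    then obtain f0 where f0: "f0 \<in> L" "f0 i = 0" "\<And>j. j \<in> I \<Longrightarrow> f0 j = g j - g i * h j"
      by (auto simp: L0_def)
    show ?thesis
      using lin[OF f0(1) h(1), of "g i"] f0 h(2)
      by (intro bexI[of _ "\<lambda>j. f0 j + g i * h j"]) auto
  qed
qed

text \<open>Direct method: coercivity bounds a minimising sequence on \<open>I\<close>, and a
  subsequence converges there. Continuity is stated in terms of the coordinates in \<open>I\<close>,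
  so the limit may be replaced by the member of \<open>L\<close> that agrees with it on
  \<open>I\<close>.\<close>

lemma coercive_attains_min_on_linear_family:
  fixes L :: "('i \<Rightarrow> real) set" and M :: "('i \<Rightarrow> real) \<Rightarrow> real"
  assumes I: "finite I" and ne: "L \<noteq> {}"
    and lin: "\<And>f g r. f \<in> L \<Longrightarrow> g \<in> L \<Longrightarrow> (\<lambda>i. f i + r * g i) \<in> L"
    and bdd: "bdd_below (M ` L)"
    and cont: "\<And>s g. (\<And>i. i \<in> I \<Longrightarrow> (\<lambda>n. s n i) \<longlonglongrightarrow> g i) \<Longrightarrow> (\<lambda>n. M (s n)) \<longlonglongrightarrow> M g"
    and coercive: "C \<ge> 0" "\<And>f i. f \<in> L \<Longrightarrow> i \<in> I \<Longrightarrow> \<bar>f i\<bar> \<le> C * M f + D"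
  shows "\<exists>f\<in>L. \<forall>g\<in>L. M f \<le> M g"
proof -
  define m where "m = (INF f\<in>L. M f)"
  have m: "m \<le> M f" if "f \<in> L" for f
    unfolding m_def using bdd that by (rule cINF_lower)
  have "\<exists>f\<in>L. M f < m + 1 / real (Suc n)" for n
    using cINF_less_iff[OF ne bdd, of "m + 1 / real (Suc n)"] by (simp add: m_def)
  then obtain s where s: "\<And>n. s n \<in> L" "\<And>n. M (s n) < m + 1 / real (Suc n)"
    by metis
  have Ms: "(\<lambda>n. M (s n)) \<longlonglongrightarrow> m"
  proof (rule tendsto_sandwich)
    show "\<forall>\<^sub>F n in sequentially. m \<le> M (s n)"
      using m s by simp
    show "\<forall>\<^sub>F n in sequentially. M (s n) \<le> m + 1 / real (Suc n)"
      using s(2) by (simp add: less_imp_le)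
    show "(\<lambda>n. m + 1 / real (Suc n)) \<longlonglongrightarrow> m"
      using tendsto_add[OF tendsto_const LIMSEQ_inverse_real_of_nat, of m]
      by (simp add: inverse_eq_divide)
  qed simp
  have "bounded (range (\<lambda>n. s n i))" if "i \<in> I" for i
  proof (rule boundedI)
    fix x assume "x \<in> range (\<lambda>n. s n i)"
    then obtain n where x: "x = s n i"
      by blast
    have "1 / real (Suc n) \<le> 1"
      by simp
    then have "C * M (s n) \<le> C * (m + 1)"
      using s(2)[of n] coercive(1) by (intro mult_left_mono) linarith+
    then show "norm x \<le> C * (m + 1) + D"
      using coercive(2)[OF s(1) that, of n] by (simp add: x)
  qed
  then obtain r where r: "strict_mono r" "\<forall>i\<in>I. convergent (\<lambda>n. s (r n) i)"
    using pointwise_bounded_convergent_subsequence[OF I, of s] by blast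
  have lim: "(\<lambda>n. s (r n) i) \<longlonglongrightarrow> lim (\<lambda>n. s (r n) i)" if "i \<in> I" for i
    using r(2) that by (simp add: convergent_LIMSEQ_iff)
  obtain f where f: "f \<in> L" "\<forall>i\<in>I. f i = lim (\<lambda>n. s (r n) i)"
    using linear_family_closed[OF I lin, of "\<lambda>n. s (r n)" "\<lambda>i. lim (\<lambda>n. s (r n) i)"] s(1) lim
    by blast
  have "(\<lambda>n. M (s (r n))) \<longlonglongrightarrow> M f"
    using lim f(2) by (intro cont) simp
  moreover have "(\<lambda>n. M (s (r n))) \<longlonglongrightarrow> m"
    using LIMSEQ_subseq_LIMSEQ[OF Ms r(1)] by (simp add: o_def)
  ultimately have "M f = m"
    by (rule LIMSEQ_unique)
  then show ?thesis
    using f(1) m by auto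
qed

section \<open>Compatible candidates\<close>

lemma tendsto_Max:
  fixes f :: "'n \<Rightarrow> 'a \<Rightarrow> 'b::linorder_topology"
  assumes "finite S" "S \<noteq> {}" "\<And>x. x \<in> S \<Longrightarrow> ((\<lambda>n. f n x) \<longlongrightarrow> l x) F"
  shows "((\<lambda>n. MAX x\<in>S. f n x) \<longlongrightarrow> (MAX x\<in>S. l x)) F"
  using assms by (induction S rule: finite_ne_induct) (auto intro!: tendsto_max)

lemma Min_const_diff:
  fixes f :: "'a \<Rightarrow> real"
  assumes "finite S" "S \<noteq> {}"
  shows "(MIN x\<in>S. k - f x) = k - (MAX x\<in>S. f x)"
proof -
  have "Max (f ` S) \<in> f ` S"
    using assms by (intro Max_in) auto
  then show ?thesis
    using assms(1) Max_ge[of "f ` S"] by (intro Min_eqI) (auto simp del: Max_ge)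
qed

text \<open>The identity for \<open>h\<close> is required on \<open>K e\<close> alone, since both
  the quadrature sum and the integral see no other points and linearity of \<open>Dcell\<close> is
  available just there.\<close>

lemma quad_defect_linear:
  assumes "K e \<in> sets lebesgue" and "\<And>q. q \<in> Q e \<Longrightarrow> pt e q \<in> K e"
    and f: "set_integrable lebesgue (K e) f" and g: "set_integrable lebesgue (K e) g"
    and h: "\<And>\<xi>. \<xi> \<in> K e \<Longrightarrow> h \<xi> = f \<xi> + r * g \<xi>"
  shows "quad_defect K Q pt w e h = quad_defect K Q pt w e f + r * quad_defect K Q pt w e g"
proof -
  have "(LINT \<xi>:K e|lebesgue. h \<xi>) = (LINT \<xi>:K e|lebesgue. f \<xi> + r * g \<xi>)"
    using assms(1) h by (intro set_lebesgue_integral_cong) auto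
  also have "\<dots> = (LINT \<xi>:K e|lebesgue. f \<xi>) + r * (LINT \<xi>:K e|lebesgue. g \<xi>)"
    using f g by (subst set_integral_add) auto
  moreover have "(\<Sum>q\<in>Q e. w e q * h (pt e q)) =
      (\<Sum>q\<in>Q e. w e q * f (pt e q)) + r * (\<Sum>q\<in>Q e. w e q * g (pt e q))"
    using assms(2) by (simp add: h sum.distrib sum_distrib_left algebra_simps)
  ultimately show ?thesis
    by (simp add: quad_defect_def algebra_simps)
qed

context discretisation
begin

section \<open>Linear dependence of gradients and compatibility on the candidate\<close>

lemma Dcell_candidate_linear:
  assumes "z \<in> Z" "z' \<in> Z" "e \<in> E" "\<xi> \<in> K e"
  shows "Dcell (K e) ((z + fscale r z') \<circ> X e) \<xi> =
    Dcell (K e) (z \<circ> X e) \<xi> + r *\<^sub>R Dcell (K e) (z' \<circ> X e) \<xi>"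
proof -
  have "(z + fscale r z') \<circ> X e = (\<lambda>y. (z \<circ> X e) y + r *\<^sub>R (z' \<circ> X e) y)"
    by (simp add: fun_eq_iff fscale_def)
  moreover have "(z \<circ> X e) differentiable (at \<xi> within K e)"
    "(z' \<circ> X e) differentiable (at \<xi> within K e)"
    using assms candidates_diff by (simp_all only: differentiable_on_def)
  ultimately show ?thesis
    using jacobian_within_convex_linear[OF polytope_imp_convex[OF parent(1)[OF assms(3)]]
        parent(2)[OF assms(3)] assms(4)]
    by (simp only:)
qed

lemma phys_grad_linear:
  assumes "z \<in> Z" "z' \<in> Z" "e \<in> E" "\<xi> \<in> K e"
  shows "phys_grad K X (z + fscale r z') e \<xi> = phys_grad K X z e \<xi> + r *\<^sub>R phys_grad K X z' e \<xi>"
  unfolding phys_grad_def Dcell_candidate_linear[OF assms]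
  by (simp add: matrix_matrix_mult_def vec_eq_iff sum.distrib sum_distrib_left algebra_simps)

lemma compat_form_linear:
  assumes "z \<in> Z" "z' \<in> Z" "e \<in> E" "u \<in> V e" "v \<in> V e"
  shows "compat_form K Q pt w e ((z + fscale r z') \<circ> X e) u v =
    compat_form K Q pt w e (z \<circ> X e) u v + r * compat_form K Q pt w e (z' \<circ> X e) u v"
  unfolding compat_form_def
proof (rule quad_defect_linear)
  show "K e \<in> sets lebesgue"
    using parent(1)[OF assms(3)] by (simp add: polytope_imp_closed borel_closed)
qed (use assms quad_points compat_integrable in
    \<open>auto simp: compat_integrand_def Dcell_candidate_linear frob_eq_inner inner_add_left\<close>)

lemma compat_space_linear:
  assumes "z \<in> compat_space E K X Q pt w V Z" "z' \<in> compat_space E K X Q pt w V Z"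
  shows "z + fscale r z' \<in> compat_space E K X Q pt w V Z"
  using assms candidates(1)
  by (auto simp: compat_space_def compat_form_linear fields.subspace_add fields.subspace_scale)

lemma zero_field_mem: "0 \<in> Z"
  using candidates(1) by (rule fields.subspace_0)

lemma Dcell_zero_field:
  assumes "e \<in> E" "\<xi> \<in> K e"
  shows "Dcell (K e) (0 \<circ> X e) \<xi> = 0"
  \<comment> \<open>For the zero field and \<open>r = -1\<close>, linearity equates its derivative
    with the difference of that derivative and itself.\<close>
  using Dcell_candidate_linear[OF zero_field_mem zero_field_mem assms, of "-1"]
  by (simp add: fscale_def[abs_def] zero_fun_def plus_fun_def)

lemma zero_field_compat: "0 \<in> compat_space E K X Q pt w V Z"
proof -
  have "compat_form K Q pt w e (0 \<circ> X e) u v = 0" if "e \<in> E" "u \<in> V e" "v \<in> V e" for e u v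
    using compat_form_linear[OF zero_field_mem zero_field_mem that, of w "-1"]
    by (simp add: fscale_def[abs_def] zero_fun_def plus_fun_def)
  then show ?thesis
    by (simp add: compat_space_def zero_field_mem)
qed

section \<open>Margin and maximal loss over the quadrature points\<close>

lemma finite_points: "finite (Sigma E Q)"
  using finite_cells quad_points by auto

text \<open>A nonempty domain is covered by at least one cell, which carries a quadrature point.
  This gives \<open>Min\<close> and \<open>Max\<close> over the points their meaning.\<close>

lemma points_nonempty: "Sigma E Q \<noteq> {}"
proof -
  have "closure \<Omega> \<noteq> {}"
    using domain(3) by (simp add: lipschitz_domain_def)
  then have "E \<noteq> {}"
    using cover by auto
  then show ?thesis
    using quad_points(2) by (auto simp: Sigma_empty_iff)
qed

text \<open>Because \<open>c1 e + c2 e = c\<close> on every cell, \<open>INF_quotient_eq\<close> has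
  the same constant at all points, and it can be pulled out of the minimum.\<close>

lemma margin_eq: "margin E K X Q pt c1 c2 z = c - max_loss E K X Q pt c z"
proof -
  have "margin E K X Q pt c1 c2 z =
      (MIN (e, q)\<in>Sigma E Q. c - coeff_loss (phys_grad K X z e (pt e q) - (2 * c) *\<^sub>R mat 1))"
    unfolding margin_def hessian_W_iso
    by (rule arg_cong[where f = Min], rule image_cong)
       (auto simp only: material(3) INF_quotient_eq prod.case)
  also have "\<dots> = c - max_loss E K X Q pt c z"
    using Min_const_diff[OF finite_points points_nonempty,
        of c "\<lambda>(e, q). coeff_loss (phys_grad K X z e (pt e q) - (2 * c) *\<^sub>R mat 1)"]
    by (simp add: max_loss_def case_prod_beta')
  finally show ?thesis .
qed

lemma max_loss_nonneg: "max_loss E K X Q pt c z \<ge> 0"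
proof -
  obtain p where p: "p \<in> Sigma E Q"
    using points_nonempty by blast
  have "0 \<le> (case p of (e, q) \<Rightarrow> coeff_loss (phys_grad K X z e (pt e q) - (2 * c) *\<^sub>R mat 1))"
    by (simp add: coeff_loss_nonneg case_prod_beta')
  also have "\<dots> \<le> max_loss E K X Q pt c z"
    unfolding max_loss_def using finite_points p by (intro Max_ge) auto
  finally show ?thesis .
qed

text \<open>The zero field is a compatible competitor, so this bound makes the optimal margin
  nonnegative.\<close>

lemma max_loss_zero_field: "max_loss E K X Q pt c 0 \<le> c"
  unfolding max_loss_def
proof (rule Max.boundedI)
  fix x assume "x \<in> (\<lambda>(e, q). coeff_loss (phys_grad K X 0 e (pt e q) - (2 * c) *\<^sub>R mat 1))
      ` Sigma E Q"
  then obtain e q where "e \<in> E" "q \<in> Q e"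
    and x: "x = coeff_loss (phys_grad K X 0 e (pt e q) - (2 * c) *\<^sub>R mat 1)"
    by auto
  then have "phys_grad K X 0 e (pt e q) = 0"
    using quad_points(3) by (simp add: phys_grad_def Dcell_zero_field)
  then show "x \<le> c"
    using coeff_loss_neg_identity[of c] material(4) by (simp add: x)
qed (use finite_points points_nonempty in auto)

text \<open>Adding a constant to a field leaves its loss unchanged, so the loss is not coercive on
  the fields themselves. The minimisation therefore runs over the arrays of gradient entries at the
  quadrature points, which determine the loss.\<close>

lemma max_loss_attains_min:
  "\<exists>z\<in>compat_space E K X Q pt w V Z. \<forall>z'\<in>compat_space E K X Q pt w V Z.
     max_loss E K X Q pt c z \<le> max_loss E K X Q pt c z'"
proof -
  let ?S = "compat_space E K X Q pt w V Z"
  define I where "I = Sigma E Q \<times> (UNIV :: (3 \<times> 3) set)"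
  \<comment> \<open>The value 0 away from the quadrature points makes \<open>grad\<close> linear as
    a map into total functions.\<close>
  define grad where "grad z = (\<lambda>((e, q), i, j).
      if (e, q) \<in> Sigma E Q then phys_grad K X z e (pt e q) $ i $ j else 0)" for z
  define U where "U f p = (\<chi> i j. f (p, i, j)) - (2 * c) *\<^sub>R mat 1"
    for f :: "('e \<times> 'q) \<times> 3 \<times> 3 \<Rightarrow> real" and p
  define M where "M f = (MAX p\<in>Sigma E Q. coeff_loss (U f p))" for f
  have M_grad: "M (grad z) = max_loss E K X Q pt c z" for z
    unfolding M_def max_loss_def
    by (rule arg_cong[where f = Max], rule image_cong) (auto simp: U_def grad_def)
  have "\<exists>f\<in>grad ` ?S. \<forall>g\<in>grad ` ?S. M f \<le> M g"
  \<comment> \<open>\<open>10 / 3\<close> comes from \<open>abs_entry_le_coeff_loss\<close>, and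
    \<open>2 * c\<close> compensates the shift of the diagonal entries in \<open>U\<close>.\<close>
  proof (rule coercive_attains_min_on_linear_family[where I = I and C = "10 / 3" and D = "2 * c"])
    show "finite I"
      using finite_points by (simp add: I_def)
    show "grad ` ?S \<noteq> {}"
      using zero_field_compat by blast
    show "bdd_below (M ` grad ` ?S)"
      by (rule bdd_belowI[of _ 0]) (auto simp: M_grad max_loss_nonneg)
    show "(\<lambda>i. f i + r * g i) \<in> grad ` ?S" if fg: "f \<in> grad ` ?S" "g \<in> grad ` ?S" for f g r
    proof -
      obtain z z' where z: "z \<in> ?S" "z' \<in> ?S" "f = grad z" "g = grad z'"
        using fg by blast
      then have "z \<in> Z" "z' \<in> Z"
        by (auto simp: compat_space_def)
      then have "grad (z + fscale r z') = (\<lambda>i. f i + r * g i)"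
        using quad_points(3) by (auto simp: fun_eq_iff grad_def z phys_grad_linear)
      then show ?thesis
        using compat_space_linear[OF z(1,2), of r] by (metis imageI)
    qed
    show "(\<lambda>n. M (s n)) \<longlonglongrightarrow> M g" if lim: "\<And>i. i \<in> I \<Longrightarrow> (\<lambda>n. s n i) \<longlonglongrightarrow> g i" for s g
      unfolding M_def
    proof (rule tendsto_Max[OF finite_points points_nonempty])
      fix p assume "p \<in> Sigma E Q"
      then have "(\<lambda>n. s n (p, i, j)) \<longlonglongrightarrow> g (p, i, j)" for i j
        by (intro lim) (simp add: I_def)
      then show "(\<lambda>n. coeff_loss (U (s n) p)) \<longlonglongrightarrow> coeff_loss (U g p)"
        unfolding U_def by (intro tendsto_coeff_loss tendsto_diff tendsto_vec_lambda tendsto_const)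
    qed
    show "\<bar>f k\<bar> \<le> 10 / 3 * M f + 2 * c" if "k \<in> I" for f k
    proof -
      obtain p i j where k: "k = (p, i, j)"
        by (cases k)
      with that have p: "p \<in> Sigma E Q"
        by (simp only: I_def mem_Times_iff fst_conv)
      have "\<bar>f k\<bar> \<le> \<bar>U f p $ i $ j\<bar> + 2 * c"
        using material(4) by (auto simp: U_def k mat_def)
      also have "\<bar>U f p $ i $ j\<bar> \<le> 10 / 3 * coeff_loss (U f p)"
        by (rule abs_entry_le_coeff_loss)
      also have "coeff_loss (U f p) \<le> M f"
        unfolding M_def using finite_points p by (intro Max_ge) auto
      finally show ?thesis
        by simp
    qed
  qed simp
  then show ?thesis
    by (auto simp: M_grad)
qed

end

theorem theorem7:
  fixes \<Omega> :: "(real^3) set" and E :: "'e set"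
    and K :: "'e \<Rightarrow> (real^3) set" and X :: "'e \<Rightarrow> real^3 \<Rightarrow> real^3"
    and Q :: "'e \<Rightarrow> 'q set" and pt :: "'e \<Rightarrow> 'q \<Rightarrow> real^3" and w :: "'e \<Rightarrow> 'q \<Rightarrow> real"
    and V :: "'e \<Rightarrow> (real^3 \<Rightarrow> real^3) set" and Z :: "(real^3 \<Rightarrow> real^3) set"
    and c1 c2 :: "'e \<Rightarrow> real" and c :: real
  assumes "discretisation \<Omega> E K X Q pt V Z c1 c2 c"
  shows "(\<forall>z\<in>Z. margin E K X Q pt c1 c2 z = c - max_loss E K X Q pt c z) \<and>
    (\<exists>\<gamma> \<mu>.
       (\<exists>z\<in>compat_space E K X Q pt w V Z. margin E K X Q pt c1 c2 z = \<gamma>) \<and>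
       (\<forall>z\<in>compat_space E K X Q pt w V Z. margin E K X Q pt c1 c2 z \<le> \<gamma>) \<and>
       (\<exists>z\<in>compat_space E K X Q pt w V Z. max_loss E K X Q pt c z = \<mu>) \<and>
       (\<forall>z\<in>compat_space E K X Q pt w V Z. \<mu> \<le> max_loss E K X Q pt c z) \<and>
       \<gamma> = c - \<mu> \<and> 0 \<le> \<gamma> \<and> \<gamma> \<le> c)"
proof -
  interpret discretisation \<Omega> E K X Q pt V Z c1 c2 c
    by (rule assms)
  obtain z where z: "z \<in> compat_space E K X Q pt w V Z"
    and min: "\<And>z'. z' \<in> compat_space E K X Q pt w V Z \<Longrightarrow>
      max_loss E K X Q pt c z \<le> max_loss E K X Q pt c z'"
    using max_loss_attains_min by blast
  \<comment> \<open>Comparison with the zero field gives the lower bound on the optimal margin; the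
    upper bound \<open>c\<close> is nonnegativity of the loss.\<close>
  have "max_loss E K X Q pt c z \<le> c"
    using min[OF zero_field_compat] max_loss_zero_field by (rule order_trans)
  then show ?thesis
    unfolding margin_eq using z min max_loss_nonneg[of z]
    by (intro conjI ballI refl exI[of _ "c - max_loss E K X Q pt c z"]
        exI[of _ "max_loss E K X Q pt c z"]) auto
qed

end
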